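(* Let $a<b$ be real numbers and let $f\in C^1[a,b]$ be real-valued. Let $L:[a,b]\times[a,b]\to\mathbb{R}$ be a function satisfying: (a) $L(x,y)+L(y,z)=L(x,z)$ for all $x,y,z\in[a,b]$; (b) $L(x,x+h)=\pm D(x,x+h)+o(h)$ as $h\to0_\pm$ for all $x\in[a,b]$, where $D(x,x+h)$ is the Euclidean distance between the points $(x,f(x))$ and $(x+h,f(x+h))$. Then $$L(a,b)=\int_a^b\sqrt{1+(f'(x))^2}\,dx.$$ Consequently, the number $L(a,b)$ (the arclength of the curve $y=f(x)$ between the points $(a,f(a))$ and $(b,f(b))$) is uniquely determined by properties (a) and (b).
   Context: In (b), the sign $+$ is taken as $h\to0_+$ and the sign $-$ as $h\to0_-$; $h\neq0$ ranges over values with $x+h\in[a,b]$ (so at $x=a$ and $x=b$ only one of the two one-sided conditions applies), and $o(h)$ denotes a quantity whose quotient by $h$ tends to $0$. $C^1[a,b]$ denotes the continuously differentiable functions on $[a,b]$ (one-sided derivatives at the endpoints). The integral is defined axiomatically: for a continuous $\rho:[a,b]\to\mathbb{R}$, $\int_a^b\rho(x)\,dx:=I(a,b)$, where $I:[a,b]\times[a,b]\to\mathbb{R}$ is the unique function with $I(x,y)+I(y,z)=I(x,z)$ for all $x,y,z\in[a,b]$ and $I(x,x+h)=\rho(x)h+o(h)$ as $h\to0$ for all $x\in[a,b]$; this coincides with the usual Riemann integral of $\rho$. *)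

theory Defs
  imports "HOL-Analysis.Analysis"
begin

text \<open>The library's metric on \<^typ>\<open>real \<times> real\<close> is the Euclidean one
  (\<^term>\<open>dist\<close> on pairs is the square root of the sum of squared distances).\<close>

definition graph_dist :: "(real \<Rightarrow> real) \<Rightarrow> real \<Rightarrow> real \<Rightarrow> real" where
  "graph_dist f x y = dist (x, f x) (y, f y)"

text \<open>A function on \<open>[a,b] \<times> [a,b]\<close> is a total curried function of which only the values at
  arguments in \<open>[a,b]\<close> are used. The one-sided conditions below say
  \<open>L(x, x+h) = \<plusminus>D(x, x+h) + o(h)\<close> as \<open>h\<close> tends to \<open>0\<close> from the right resp. left, where
  \<open>x + h\<close> stays in \<open>[a,b]\<close>. At \<open>x = b\<close> (resp. \<open>x = a\<close>) the set of increments in the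
  right-hand (resp. left-hand) condition is empty, so the filter is trivial and the condition
  is vacuous.\<close>

definition arclength_function ::
    "real \<Rightarrow> real \<Rightarrow> (real \<Rightarrow> real) \<Rightarrow> (real \<Rightarrow> real \<Rightarrow> real) \<Rightarrow> bool" where
  "arclength_function a b f L \<longleftrightarrow>
     (\<forall>x\<in>{a..b}. \<forall>y\<in>{a..b}. \<forall>z\<in>{a..b}. L x y + L y z = L x z) \<and>
     (\<forall>x\<in>{a..b}.
        ((\<lambda>h. (L x (x + h) - graph_dist f x (x + h)) / h) \<longlongrightarrow> 0)
          (at 0 within {h. 0 < h \<and> x + h \<in> {a..b}}) \<and>
        ((\<lambda>h. (L x (x + h) - (- graph_dist f x (x + h))) / h) \<longlongrightarrow> 0)
          (at 0 within {h. h < 0 \<and> x + h \<in> {a..b}}))"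

end

(* By additivity t \<mapsto> L a t has increments L x y. Since
   \<plusminus>D(x,y) / (y - x) = sqrt (1 + ((f y - f x) / (y - x))^2), condition (b) says that its derivative
   is sqrt (1 + (f' x)^2), and the fundamental theorem of calculus applies. *)
theory Submission
  imports Defs
begin

text \<open>The factor \<open>sgn (y - x)\<close> merges the two signs of condition (b) into one
  formula. It turns the denominator into an absolute value, which can be moved under the root as a
  square.\<close>

lemma signed_graph_dist_quotient:
  assumes "x \<noteq> y"
  shows "sgn (y - x) * graph_dist f x y / (y - x) = sqrt (1 + ((f y - f x) / (y - x))\<^sup>2)"
proof -
  have "sgn (y - x) * graph_dist f x y / (y - x) = graph_dist f x y / \<bar>y - x\<bar>"
    using assms minus_divide_right[of "graph_dist f x y" "y - x"] by (simp add: sgn_if abs_if)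
  also have "\<dots> = sqrt (((x - y)\<^sup>2 + (f x - f y)\<^sup>2) / (y - x)\<^sup>2)"
    by (simp add: graph_dist_def dist_prod_def dist_real_def real_sqrt_divide)
  also have "((x - y)\<^sup>2 + (f x - f y)\<^sup>2) / (y - x)\<^sup>2 = 1 + ((f y - f x) / (y - x))\<^sup>2"
    using assms by (simp add: add_divide_distrib power_divide power2_commute)
  finally show ?thesis .
qed

text \<open>The two one-sided limits in (b) glue together, because the parts of the interval on
  either side of \<open>x\<close> make up the interval without \<open>x\<close>. At an endpoint one
  part is empty and its limit is trivial.\<close>

lemma arclength_function_error_tendsto:
  assumes "arclength_function a b f L" "x \<in> {a..b}"
  shows "((\<lambda>y. (L x y - sgn (y - x) * graph_dist f x y) / (y - x)) \<longlongrightarrow> 0) (at x within {a..b})"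
    (is "(?e \<longlongrightarrow> 0) _")
proof -
  \<comment> \<open>This justifies the substitution \<open>h = y - x\<close> in the limits of
    (b).\<close>
  have shift: "filterlim (\<lambda>y. y - x) (at 0 within T) (at x within S)"
    if "\<And>y. y \<in> S \<Longrightarrow> y - x \<in> T" "x \<notin> S" for S T :: "real set"
    unfolding filterlim_at
  proof
    show "\<forall>\<^sub>F y in at x within S. y - x \<in> T \<and> y - x \<noteq> 0"
      using that by (auto simp: eventually_at_filter)
    show "((\<lambda>y. y - x) \<longlongrightarrow> 0) (at x within S)"
      by (auto intro!: tendsto_eq_intros)
  qed
  have R: "((\<lambda>h. (L x (x + h) - graph_dist f x (x + h)) / h) \<longlongrightarrow> 0)
          (at 0 within {h. 0 < h \<and> x + h \<in> {a..b}})"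
    and N: "((\<lambda>h. (L x (x + h) - (- graph_dist f x (x + h))) / h) \<longlongrightarrow> 0)
          (at 0 within {h. h < 0 \<and> x + h \<in> {a..b}})"
    using assms unfolding arclength_function_def by blast+
  have "(?e \<longlongrightarrow> 0) (at x within ({a..b} \<inter> {x<..}))"
    \<comment> \<open>On each side \<open>sgn (y - x)\<close> is constant, so the functions agree on
      the whole side; the radius \<open>1\<close> is arbitrary.\<close>
    by (rule Lim_transform_within[OF filterlim_compose[OF R shift], of _ 1]) auto
  moreover have "(?e \<longlongrightarrow> 0) (at x within ({a..b} \<inter> {..<x}))"
    by (rule Lim_transform_within[OF filterlim_compose[OF N shift], of _ 1]) auto
  ultimately have "(?e \<longlongrightarrow> 0) (at x within ({a..b} \<inter> {x<..} \<union> {a..b} \<inter> {..<x}))"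
    by (simp add: Lim_within_Un)
  moreover have "({a..b} \<inter> {x<..} \<union> {a..b} \<inter> {..<x}) = {a..b} - {x}"
    by auto
  ultimately show ?thesis
    by (simp add: at_within_def)
qed

text \<open>The difference quotient of \<open>L a\<close> splits into the error quotient, which
  tends to 0, and a continuous function of the difference quotient of \<open>f\<close>.\<close>

lemma arclength_function_has_derivative:
  assumes L: "arclength_function a b f L" and x: "x \<in> {a..b}"
    and f: "(f has_real_derivative d) (at x within {a..b})"
  shows "(L a has_real_derivative sqrt (1 + d\<^sup>2)) (at x within {a..b})"
proof -
  have "((\<lambda>y. sqrt (1 + ((f y - f x) / (y - x))\<^sup>2)) \<longlongrightarrow> sqrt (1 + d\<^sup>2)) (at x within {a..b})"
    using f unfolding has_field_derivative_iff by (intro tendsto_intros)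
  from tendsto_add[OF arclength_function_error_tendsto[OF L x] this]
  have "((\<lambda>y. (L x y - sgn (y - x) * graph_dist f x y) / (y - x)
          + sqrt (1 + ((f y - f x) / (y - x))\<^sup>2)) \<longlongrightarrow> sqrt (1 + d\<^sup>2)) (at x within {a..b})"
    by simp
  then have "((\<lambda>y. (L a y - L a x) / (y - x)) \<longlongrightarrow> sqrt (1 + d\<^sup>2)) (at x within {a..b})"
  proof (rule Lim_transform_within[of _ _ _ _ 1])
    fix y assume y: "y \<in> {a..b}" "0 < dist y x"
    have "a \<in> {a..b}"
      using x by simp
    then have "L a x + L x y = L a y"
      using L x y unfolding arclength_function_def by blast
    moreover have "x \<noteq> y"
      using y by auto
    ultimately show "(L x y - sgn (y - x) * graph_dist f x y) / (y - x)
          + sqrt (1 + ((f y - f x) / (y - x))\<^sup>2) = (L a y - L a x) / (y - x)"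
      \<comment> \<open>Writing the root as the signed distance quotient again makes the distance
        terms cancel, leaving \<open>L x y / (y - x)\<close>.\<close>
      unfolding signed_graph_dist_quotient[OF \<open>x \<noteq> y\<close>, symmetric]
      by (simp add: diff_divide_distrib flip: \<open>L a x + L x y = L a y\<close>)
  qed simp
  then show ?thesis
    by (simp add: has_field_derivative_iff)
qed

lemma arclength_function_eq_integral:
  assumes "a \<le> b" and L: "arclength_function a b f L"
    and "\<And>x. x \<in> {a..b} \<Longrightarrow> (f has_real_derivative f' x) (at x within {a..b})"
  shows "L a b = integral {a..b} (\<lambda>x. sqrt (1 + (f' x)\<^sup>2))"
proof -
  have "((\<lambda>x. sqrt (1 + (f' x)\<^sup>2)) has_integral (L a b - L a a)) {a..b}"
    using assms
    by (intro fundamental_theorem_of_calculus)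
      (auto intro!: arclength_function_has_derivative
        simp flip: has_real_derivative_iff_has_vector_derivative)
  \<comment> \<open>Additivity at three equal points forces \<open>L a a = 0\<close>, which removes
    the lower boundary term.\<close>
  moreover have "L a a + L a a = L a a"
    using L \<open>a \<le> b\<close> unfolding arclength_function_def by force
  ultimately show ?thesis
    by (simp add: integral_unique)
qed

text \<open>Derivatives within \<open>{a..b}\<close> are one-sided at the endpoints. The integrand
  is continuous, so \<open>integral\<close> has the value of the Riemann integral. Uniqueness
  follows since the integral does not depend on \<open>L\<close>.\<close>

theorem theorem4p2:
  fixes a b :: real and f f' :: "real \<Rightarrow> real"
  assumes "a < b"
    and "\<And>x. x \<in> {a..b} \<Longrightarrow> (f has_real_derivative f' x) (at x within {a..b})"
    and "continuous_on {a..b} f'"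
  shows "(\<forall>L. arclength_function a b f L \<longrightarrow>
              L a b = integral {a..b} (\<lambda>x. sqrt (1 + (f' x)\<^sup>2))) \<and>
         (\<forall>L1 L2. arclength_function a b f L1 \<longrightarrow> arclength_function a b f L2 \<longrightarrow>
              L1 a b = L2 a b)"
proof -
  have "L a b = integral {a..b} (\<lambda>x. sqrt (1 + (f' x)\<^sup>2))" if "arclength_function a b f L" for L
    using arclength_function_eq_integral[OF less_imp_le[OF assms(1)] that assms(2)] .
  then show ?thesis
    by metis
qed

end
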